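(* Let $I=\{1,\dots,m\}$, $J=\{1,\dots,n\}$, and consider the interval transportation problem (ITP$^\le$) with interval data $\mathbf{c}=[\underline{c},\overline{c}]$, $\mathbf{s}=[\underline{s},\overline{s}]$, $\mathbf{d}=[\underline{d},\overline{d}]$. If $\underline{c}=\overline{c}$, then a given $x\in\mathbb{R}^{m\times n}$ is a strongly optimal solution of (ITP$^\le$) if and only if it is a strongly feasible solution of (ITP$^\le$) and it is also an optimal solution of the linear program $$\begin{aligned} \text{minimize }\ & \sum_{i\in I}\sum_{j\in J}\overline{c}_{ij}x_{ij}\\ \text{subject to }\ & \sum_{j\in J}x_{ij}\le\overline{s}_i, && \forall i\in I,\\ & \sum_{i\in I}x_{ij}=\overline{d}_j, && \forall j\in J,\\ & x_{ij}\ge 0, && \forall i\in I,\ j\in J. \end{aligned}$$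
   Context: For real vectors (or matrices) $\underline{a}\le\overline{a}$ (element-wise), $\mathbf{a}=[\underline{a},\overline{a}]=\{a:\underline{a}\le a\le\overline{a}\}$ denotes an interval vector (or matrix). Given non-negative interval data: costs $\mathbf{c}=[\underline{c},\overline{c}]$ with $\underline{c},\overline{c}\in\mathbb{R}^{m\times n}$, supplies $\mathbf{s}=[\underline{s},\overline{s}]$ with $\underline{s},\overline{s}\in\mathbb{R}^m$, demands $\mathbf{d}=[\underline{d},\overline{d}]$ with $\underline{d},\overline{d}\in\mathbb{R}^n$ (all lower bounds are $\ge 0$), the interval transportation problem (ITP$^\le$) is the family of all linear programs $$\text{minimize }\sum_{i\in I}\sum_{j\in J}c_{ij}x_{ij}\ \text{ subject to }\ \sum_{j\in J}x_{ij}\le s_i\ (\forall i\in I),\quad \sum_{i\in I}x_{ij}=d_j\ (\forall j\in J),\quad x_{ij}\ge 0\ (\forall i\in I,j\in J),$$ with $c\in\mathbf{c}$, $s\in\mathbf{s}$, $d\in\mathbf{d}$. Each such linear program is called the scenario $(c,s,d)$. A given $x\in\mathbb{R}^{m\times n}$ is a strongly feasible (respectively strongly optimal) solution if it is feasible (respectively an optimal solution) for every scenario $(c,s,d)$ with $c\in\mathbf{c}$, $s\in\mathbf{s}$, $d\in\mathbf{d}$. *)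

theory Defs
  imports "HOL-Analysis.Analysis"
begin

text \<open>
  The entry \<open>x $ i $ j\<close> of \<open>x :: real ^ 'n ^ 'm\<close> is the amount shipped from supply node \<open>i :: 'm\<close> to
  demand node \<open>j :: 'n\<close>. The order on vectors and matrices is element-wise, so \<open>{a..b}\<close> is the
  interval vector or interval matrix with bounds \<open>a\<close> and \<open>b\<close>.
\<close>

definition tp_cost :: "real ^ 'n ^ 'm \<Rightarrow> real ^ 'n ^ 'm \<Rightarrow> real" where
  "tp_cost c x = (\<Sum>i\<in>UNIV. \<Sum>j\<in>UNIV. c $ i $ j * x $ i $ j)"

definition tp_feasible :: "real ^ 'm \<Rightarrow> real ^ 'n \<Rightarrow> real ^ 'n ^ 'm \<Rightarrow> bool" where
  "tp_feasible s d x \<longleftrightarrow>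
     (\<forall>i. (\<Sum>j\<in>UNIV. x $ i $ j) \<le> s $ i) \<and>
     (\<forall>j. (\<Sum>i\<in>UNIV. x $ i $ j) = d $ j) \<and>
     (\<forall>i j. 0 \<le> x $ i $ j)"

definition tp_optimal ::
  "real ^ 'n ^ 'm \<Rightarrow> real ^ 'm \<Rightarrow> real ^ 'n \<Rightarrow> real ^ 'n ^ 'm \<Rightarrow> bool" where
  "tp_optimal c s d x \<longleftrightarrow>
     tp_feasible s d x \<and> (\<forall>y. tp_feasible s d y \<longrightarrow> tp_cost c x \<le> tp_cost c y)"

definition itp_strongly_feasible ::
  "(real ^ 'n ^ 'm) set \<Rightarrow> (real ^ 'm) set \<Rightarrow> (real ^ 'n) set \<Rightarrow> real ^ 'n ^ 'm \<Rightarrow> bool" where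
  "itp_strongly_feasible C S D x \<longleftrightarrow> (\<forall>c\<in>C. \<forall>s\<in>S. \<forall>d\<in>D. tp_feasible s d x)"

definition itp_strongly_optimal ::
  "(real ^ 'n ^ 'm) set \<Rightarrow> (real ^ 'm) set \<Rightarrow> (real ^ 'n) set \<Rightarrow> real ^ 'n ^ 'm \<Rightarrow> bool" where
  "itp_strongly_optimal C S D x \<longleftrightarrow> (\<forall>c\<in>C. \<forall>s\<in>S. \<forall>d\<in>D. tp_optimal c s d x)"

end

theory Submission
  imports Defs
begin

text \<open>
  The upper scenario is one of the scenarios, so strong optimality trivially gives both conditions on
  the right. Conversely, a strongly feasible \<open>x\<close> meets every demand vector with equality, so the
  demands are determined by the column sums of \<open>x\<close> and the demand interval is a single point
  (\<open>tp_feasible_demand_unique\<close>). With the costs fixed too, only the supplies vary, and lowering them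
  shrinks the feasible set. A point that is optimal for the largest supplies and feasible for smaller
  ones is therefore still optimal (\<open>tp_optimal_antimono_supply\<close>).
\<close>

lemma tp_feasible_demand_unique:
  assumes "tp_feasible s d x" and "tp_feasible s' d' x"
  shows "d = d'"
  using assms unfolding tp_feasible_def vec_eq_iff by metis

lemma tp_feasible_mono_supply:
  assumes "tp_feasible s d x" and "s \<le> s'"
  shows "tp_feasible s' d x"
  using assms unfolding tp_feasible_def less_eq_vec_def by (meson order_trans)

lemma tp_optimal_antimono_supply:
  assumes "tp_optimal c s' d x" and "tp_feasible s d x" and "s \<le> s'"
  shows "tp_optimal c s d x"
  using assms tp_feasible_mono_supply unfolding tp_optimal_def by blast

theorem proposition5:
  fixes c_lo c_up :: "real ^ 'n ^ 'm"
    and s_lo s_up :: "real ^ 'm"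
    and d_lo d_up :: "real ^ 'n"
    and x :: "real ^ 'n ^ 'm"
  assumes "0 \<le> c_lo" and "c_lo \<le> c_up"
    and "0 \<le> s_lo" and "s_lo \<le> s_up"
    and "0 \<le> d_lo" and "d_lo \<le> d_up"
    and "c_lo = c_up"
  shows "itp_strongly_optimal {c_lo..c_up} {s_lo..s_up} {d_lo..d_up} x \<longleftrightarrow>
           itp_strongly_feasible {c_lo..c_up} {s_lo..s_up} {d_lo..d_up} x \<and>
           tp_optimal c_up s_up d_up x"
proof
  assume L: "itp_strongly_optimal {c_lo..c_up} {s_lo..s_up} {d_lo..d_up} x"
  then have "itp_strongly_feasible {c_lo..c_up} {s_lo..s_up} {d_lo..d_up} x"
    unfolding itp_strongly_optimal_def itp_strongly_feasible_def tp_optimal_def by blast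
  moreover have "c_up \<in> {c_lo..c_up}" "s_up \<in> {s_lo..s_up}" "d_up \<in> {d_lo..d_up}"
    using assms(2,4,6) by simp_all
  with L have "tp_optimal c_up s_up d_up x"
    unfolding itp_strongly_optimal_def by blast
  ultimately show "itp_strongly_feasible {c_lo..c_up} {s_lo..s_up} {d_lo..d_up} x \<and>
      tp_optimal c_up s_up d_up x" ..
next
  assume R: "itp_strongly_feasible {c_lo..c_up} {s_lo..s_up} {d_lo..d_up} x \<and>
      tp_optimal c_up s_up d_up x"
  show "itp_strongly_optimal {c_lo..c_up} {s_lo..s_up} {d_lo..d_up} x"
    unfolding itp_strongly_optimal_def
  proof (intro ballI)
    fix c s d
    assume c: "c \<in> {c_lo..c_up}" and s: "s \<in> {s_lo..s_up}" and d: "d \<in> {d_lo..d_up}"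
    have "c = c_up"
      using c assms(7) by simp
    have feas: "tp_feasible s d x"
      using R c s d unfolding itp_strongly_feasible_def by blast
    have "tp_feasible s_up d_up x"
      using R unfolding tp_optimal_def by blast
    with feas have "d = d_up"
      by (rule tp_feasible_demand_unique)
    show "tp_optimal c s d x"
      using R feas s tp_optimal_antimono_supply
      unfolding \<open>c = c_up\<close> \<open>d = d_up\<close> by auto
  qed
qed

end
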